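(* Let $G$ be a finite simple graph and let $k\ge 1$ be an integer. Then for each $i=1,\ldots,k$, the number $4\cos^2\!\big(\pi i/(2k+1)\big)$ is an eigenvalue of the Laplacian matrix $L(G)$ with multiplicity at least $p_k(G)-q_k(G)$, and it is also an eigenvalue of the signless Laplacian matrix $Q(G)$ with multiplicity at least $p_k(G)-q_k(G)$.
   Context: A pendant path of $G$ is a path in $G$ such that one of its end vertices has degree $1$ in $G$, the other end vertex has degree $\ge 3$ in $G$, and all its internal vertices have degree $2$ in $G$. Its length is its number of edges. $p_k(G)$ denotes the number of pendant paths of length $k$ in $G$, and $q_k(G)$ denotes the number of vertices of degree $\ge 3$ that are an end vertex of at least one pendant path of length $k$. The Laplacian matrix is $L(G)=\Delta-A$ and the signless Laplacian is $Q(G)=\Delta+A$, where $A$ is the adjacency matrix and $\Delta$ the diagonal matrix of vertex degrees. *)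

theory Defs
  imports "HOL-Analysis.Analysis"
begin

text \<open>
  A finite simple graph is a symmetric, irreflexive adjacency relation on a finite type of
  vertices, so that its matrices are square matrices indexed by that type.
\<close>

definition simple_graph :: "('v::finite \<Rightarrow> 'v \<Rightarrow> bool) \<Rightarrow> bool" where
  "simple_graph E \<longleftrightarrow> symp E \<and> irreflp E"

definition vdegree :: "('v::finite \<Rightarrow> 'v \<Rightarrow> bool) \<Rightarrow> 'v \<Rightarrow> nat" where
  "vdegree E v = card {w. E v w}"

definition adjacency_matrix :: "('v::finite \<Rightarrow> 'v \<Rightarrow> bool) \<Rightarrow> real^'v^'v" where
  "adjacency_matrix E = (\<chi> v w. if E v w then 1 else 0)"

definition degree_matrix :: "('v::finite \<Rightarrow> 'v \<Rightarrow> bool) \<Rightarrow> real^'v^'v" where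
  "degree_matrix E = (\<chi> v w. if v = w then real (vdegree E v) else 0)"

definition laplacian :: "('v::finite \<Rightarrow> 'v \<Rightarrow> bool) \<Rightarrow> real^'v^'v" where
  "laplacian E = degree_matrix E - adjacency_matrix E"

definition signless_laplacian :: "('v::finite \<Rightarrow> 'v \<Rightarrow> bool) \<Rightarrow> real^'v^'v" where
  "signless_laplacian E = degree_matrix E + adjacency_matrix E"

definition path_in :: "('v::finite \<Rightarrow> 'v \<Rightarrow> bool) \<Rightarrow> 'v list \<Rightarrow> bool" where
  "path_in E xs \<longleftrightarrow> xs \<noteq> [] \<and> distinct xs \<and> successively E xs"

text \<open>
  A pendant path is listed from its end vertex of degree 1 to its end vertex of degree at
  least 3. As these degrees differ, each pendant path (as a subgraph) corresponds to exactly
  one such list, so counting the lists counts the paths.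
\<close>

definition pendant_path :: "('v::finite \<Rightarrow> 'v \<Rightarrow> bool) \<Rightarrow> nat \<Rightarrow> 'v list \<Rightarrow> bool" where
  "pendant_path E k xs \<longleftrightarrow>
     path_in E xs \<and> length xs = k + 1 \<and>
     vdegree E (hd xs) = 1 \<and> vdegree E (last xs) \<ge> 3 \<and>
     (\<forall>v \<in> set (butlast (tl xs)). vdegree E v = 2)"

definition num_pendant_paths :: "('v::finite \<Rightarrow> 'v \<Rightarrow> bool) \<Rightarrow> nat \<Rightarrow> nat" where
  "num_pendant_paths E k = card {xs. pendant_path E k xs}"

definition num_pendant_roots :: "('v::finite \<Rightarrow> 'v \<Rightarrow> bool) \<Rightarrow> nat \<Rightarrow> nat" where
  "num_pendant_roots E k =
     card {v. vdegree E v \<ge> 3 \<and> (\<exists>xs. pendant_path E k xs \<and> (v = hd xs \<or> v = last xs))}"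

text \<open>
  Multiplicity is the dimension of the eigenspace, which is 0 if \<open>c\<close> is not an eigenvalue.
  For symmetric matrices, such as both Laplacians, it agrees with the multiplicity of \<open>c\<close>
  as a root of the characteristic polynomial.
\<close>

definition eigenvalue_multiplicity :: "real^'n^'n \<Rightarrow> real \<Rightarrow> nat" where
  "eigenvalue_multiplicity A c = dim {x. A *v x = c *s x}"

end

theory Submission
  imports Defs
begin

text \<open>
  Write \<open>\<theta> = \<pi> i / (2k + 1)\<close> and \<open>M = \<Delta> + s A\<close> with \<open>s = \<plusminus>1\<close>. On a pendant path
  \<open>x\<^sub>0, \<dots>, x\<^sub>k\<close>, listed from its leaf, put the weight \<open>s\<^sup>j sin ((2j + 1) \<theta>)\<close> on \<open>x\<^sub>j\<close>.
  These weights solve the three-term recurrence of \<open>M - 4 cos\<^sup>2 \<theta>\<close> along the path, satisfy its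
  boundary condition at the leaf and vanish at \<open>x\<^sub>k\<close>, so \<open>M - 4 cos\<^sup>2 \<theta>\<close> maps the resulting
  vector to a multiple of the unit vector of \<open>x\<^sub>k\<close> that does not depend on the path. Hence the
  difference of the vectors of two paths with the same root is an eigenvector. Subtracting from
  every path a chosen path with the same root gives \<open>p\<^sub>k - q\<^sub>k\<close> eigenvectors, which are
  independent because a leaf lies on only one pendant path.
\<close>

section \<open>Linear algebra: a dimension bound from dual coordinates\<close>

lemma card_le_dim_if_dual_coordinates:
  fixes w :: "'a \<Rightarrow> real^'n" and h :: "'a \<Rightarrow> 'n"
  assumes "finite S" and "\<And>p. p \<in> S \<Longrightarrow> w p \<in> V" and "a \<noteq> 0"
    and coord: "\<And>p q. p \<in> S \<Longrightarrow> q \<in> S \<Longrightarrow> w p $ h q = (if p = q then a else 0)"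
  shows "card S \<le> dim V"
proof -
  have inj: "inj_on w S"
    by (rule inj_onI) (metis coord \<open>a \<noteq> 0\<close>)
  have "independent (w ` S)"
  proof (rule independent_if_scalars_zero)
    fix f x assume sum0: "(\<Sum>x\<in>w ` S. f x *\<^sub>R x) = 0" and "x \<in> w ` S"
    then obtain q where q: "q \<in> S" "x = w q" by blast
    \<comment> \<open>Reading off coordinate \<open>h q\<close> isolates the coefficient of
      \<open>w q\<close>.\<close>
    have "0 = (\<Sum>p\<in>S. f (w p) *\<^sub>R w p) $ h q"
      using sum0 by (simp add: sum.reindex[OF inj])
    also have "\<dots> = (\<Sum>p\<in>S. if p = q then f (w p) * a else 0)"
      by (auto simp: coord q intro!: sum.cong)
    also have "\<dots> = f (w q) * a"
      using \<open>finite S\<close> q by simp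
    finally show "f x = 0" using q \<open>a \<noteq> 0\<close> by simp
  qed (use \<open>finite S\<close> in simp)
  then have "card (w ` S) \<le> dim V"
    using assms(2) by (intro independent_card_le_dim) auto
  then show ?thesis by (simp add: card_image[OF inj])
qed

section \<open>Pendant paths and their leaves\<close>

lemma eq_if_card_2_not_eq:
  assumes "card A = 2" "x \<in> A" "y \<in> A" "x \<noteq> y"
  shows "A = {x, y}"
  using assms card_ge_0_finite[of A] card_subset_eq[of A "{x, y}"] by simp

lemma pendant_path_length: "pendant_path E k xs \<Longrightarrow> length xs = Suc k"
  by (simp add: pendant_path_def)

lemma pendant_path_hd: "pendant_path E k xs \<Longrightarrow> hd xs = xs ! 0"
  by (auto simp: pendant_path_def path_in_def hd_conv_nth)

lemma pendant_path_last: "pendant_path E k xs \<Longrightarrow> last xs = xs ! k"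
  by (auto simp: pendant_path_def path_in_def last_conv_nth)

lemma pendant_path_vdegree_inner:
  assumes "pendant_path E k xs" "0 < j" "j < k"
  shows "vdegree E (xs ! j) = 2"
proof -
  have "butlast (tl xs) ! (j - 1) = xs ! j" "j - 1 < length (butlast (tl xs))"
    using assms pendant_path_length[OF assms(1)] by (auto simp: nth_butlast nth_tl)
  then have "xs ! j \<in> set (butlast (tl xs))" by (metis nth_mem)
  then show ?thesis using assms(1) by (auto simp: pendant_path_def)
qed

lemma pendant_path_edge:
  assumes "pendant_path E k xs" "j < k"
  shows "E (xs ! j) (xs ! Suc j)"
  using assms by (auto simp: pendant_path_def path_in_def successively_conv_nth)

lemma pendant_path_neighbours_0:
  assumes "pendant_path E k xs" "k \<ge> 1"
  shows "{w. E (xs ! 0) w} = {xs ! 1}"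
proof -
  have "card {w. E (xs ! 0) w} = 1"
    using assms(1) pendant_path_hd[OF assms(1)] by (auto simp: pendant_path_def vdegree_def)
  moreover have "E (xs ! 0) (xs ! 1)"
    using pendant_path_edge[OF assms(1), of 0] assms(2) by simp
  ultimately show ?thesis
    by (metis card_1_singletonE mem_Collect_eq singletonD)
qed

text \<open>The two path neighbours exhaust the degree 2. Their distinctness is recorded because it
  splits a sum over the neighbours into two terms.\<close>

lemma pendant_path_neighbours_Suc:
  assumes "simple_graph E" "pendant_path E k xs" "Suc j < k"
  shows "{w. E (xs ! Suc j) w} = {xs ! j, xs ! Suc (Suc j)}"
    and "xs ! j \<noteq> xs ! Suc (Suc j)"
proof -
  show ne: "xs ! j \<noteq> xs ! Suc (Suc j)"
    using assms(2,3) by (auto simp: pendant_path_def path_in_def nth_eq_iff_index_eq)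
  have "E (xs ! Suc j) (xs ! j)"
    using pendant_path_edge[OF assms(2), of j] assms(1,3)
    by (auto simp: simple_graph_def dest: sympD)
  moreover have "E (xs ! Suc j) (xs ! Suc (Suc j))"
    using pendant_path_edge[OF assms(2,3)] .
  moreover have "card {w. E (xs ! Suc j) w} = 2"
    using pendant_path_vdegree_inner[OF assms(2), of "Suc j"] assms(3) by (simp add: vdegree_def)
  ultimately show "{w. E (xs ! Suc j) w} = {xs ! j, xs ! Suc (Suc j)}"
    using ne by (intro eq_if_card_2_not_eq) auto
qed

text \<open>Walking away from the leaf leaves no choice: each inner vertex has only one neighbour
  besides its predecessor.\<close>

lemma pendant_path_eq_if_hd_eq:
  assumes "simple_graph E" "k \<ge> 1" and p: "pendant_path E k p" and q: "pendant_path E k q"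
    and "p ! 0 = q ! 0"
  shows "p = q"
proof -
  \<comment> \<open>Two consecutive vertices are carried along, since both are needed to determine
    the next one.\<close>
  have step: "p ! j = q ! j \<and> p ! Suc j = q ! Suc j" if "j < k" for j
    using that
  proof (induction j)
    case 0
    then show ?case
      using pendant_path_neighbours_0[OF p \<open>k \<ge> 1\<close>] pendant_path_neighbours_0[OF q \<open>k \<ge> 1\<close>]
        \<open>p ! 0 = q ! 0\<close> by auto
  next
    case (Suc j)
    then have IH: "p ! j = q ! j" "p ! Suc j = q ! Suc j" by auto
    have "{p ! j, p ! Suc (Suc j)} = {q ! j, q ! Suc (Suc j)}"
      using pendant_path_neighbours_Suc(1)[OF assms(1) p Suc.prems]
        pendant_path_neighbours_Suc(1)[OF assms(1) q Suc.prems] IH by simp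
    then show ?case
      using IH by (auto simp: doubleton_eq_iff)
  qed
  show ?thesis
  proof (rule nth_equalityI)
    fix j assume "j < length p"
    then have "j \<le> k" using pendant_path_length[OF p] by simp
    then show "p ! j = q ! j"
      using step[of j] step[of "k - 1"] \<open>k \<ge> 1\<close> by (cases "j = k") auto
  qed (simp add: pendant_path_length[OF p] pendant_path_length[OF q])
qed

text \<open>Degrees 1 and 2 tell the leaf from the inner vertices. This makes the leaves usable as
  dual coordinates; the root may be left out because it carries no weight.\<close>

lemma pendant_path_hd_unique:
  assumes "simple_graph E" "k \<ge> 1" and p: "pendant_path E k p" and q: "pendant_path E k q"
    and "j < k" "p ! j = q ! 0"
  shows "j = 0 \<and> p = q"
proof -
  have "vdegree E (p ! j) = 1"
    using q pendant_path_hd[OF q] \<open>p ! j = q ! 0\<close> by (simp add: pendant_path_def)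
  then have "j = 0"
    using pendant_path_vdegree_inner[OF p _ \<open>j < k\<close>] by (cases "j = 0") auto
  then show ?thesis
    using pendant_path_eq_if_hd_eq[OF assms(1,2) p q] \<open>p ! j = q ! 0\<close> by simp
qed

section \<open>Both Laplacians as one family of matrices\<close>

definition signed_laplacian :: "real \<Rightarrow> ('v::finite \<Rightarrow> 'v \<Rightarrow> bool) \<Rightarrow> real^'v^'v" where
  "signed_laplacian s E = degree_matrix E + s *\<^sub>R adjacency_matrix E"

lemma signed_laplacian_axis:
  assumes "simple_graph E"
  shows "signed_laplacian s E *v axis v 1
    = real (vdegree E v) *\<^sub>R axis v 1 + s *\<^sub>R (\<Sum>w | E v w. axis w 1)"
proof (rule vec_eq_iff[THEN iffD2], rule allI)
  fix u
  have sym: "E u v = E v u"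
    using assms by (auto simp: simple_graph_def dest: sympD)
  have "(\<Sum>w | E v w. axis w 1 :: real^'a) $ u = (\<Sum>w | E v w. if w = u then 1 else 0)"
    by (simp add: axis_def eq_commute)
  also have "\<dots> = (if E v u then 1 else 0)"
    by simp
  finally have nb: "(\<Sum>w | E v w. axis w 1 :: real^'a) $ u = (if E v u then 1 else 0)" .
  show "(signed_laplacian s E *v axis v 1) $ u
      = (real (vdegree E v) *\<^sub>R axis v 1 + s *\<^sub>R (\<Sum>w | E v w. axis w 1)) $ u"
    unfolding matrix_vector_mult_basis vector_add_component vector_scaleR_component nb
    by (auto simp: column_def signed_laplacian_def degree_matrix_def adjacency_matrix_def sym axis_def)
qed

section \<open>Trigonometric weights along a path\<close>

definition path_weight :: "real \<Rightarrow> real \<Rightarrow> nat \<Rightarrow> real" where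
  "path_weight s \<theta> j = s ^ j * sin (real (2 * j + 1) * \<theta>)"

text \<open>The cutoff \<open>n\<close> allows induction over initial segments; \<open>n = k\<close>
  stops just before the root.\<close>

definition path_vector :: "real \<Rightarrow> real \<Rightarrow> nat \<Rightarrow> 'v::finite list \<Rightarrow> real^'v" where
  "path_vector s \<theta> n p = (\<Sum>j<n. path_weight s \<theta> j *\<^sub>R axis (p ! j) 1)"

lemma four_cos_squared: "4 * (cos \<theta>)\<^sup>2 = 2 + 2 * cos (2 * \<theta>)" for \<theta> :: real
  by (simp add: cos_double_cos)

lemma sin_add_sin_diff: "sin (x + y) + sin (x - y) = 2 * cos y * sin x" for x y :: real
  by (simp add: sin_add sin_diff)

text \<open>A fictitious predecessor of the leaf would contribute
  \<open>sin (- \<theta>) = - sin \<theta>\<close>, which turns the diagonal coefficient 2 of an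
  inner vertex into the degree 1 of the leaf.\<close>

lemma path_weight_leaf:
  assumes "s * s = 1"
  shows "path_weight s \<theta> 0 + s * path_weight s \<theta> 1 = 4 * (cos \<theta>)\<^sup>2 * path_weight s \<theta> 0"
proof -
  have "sin (\<theta> + 2 * \<theta>) + sin (\<theta> - 2 * \<theta>) = 2 * cos (2 * \<theta>) * sin \<theta>"
    by (rule sin_add_sin_diff)
  moreover have "s * path_weight s \<theta> 1 = sin (\<theta> + 2 * \<theta>)"
    using assms by (simp add: path_weight_def distrib_right flip: mult.assoc)
  ultimately show ?thesis
    unfolding four_cos_squared by (simp only:) (simp add: path_weight_def distrib_right)
qed

text \<open>Neighbouring angles differ by \<open>2 * \<theta>\<close>, so their sines add up to a
  multiple of the middle one; \<open>s * s = 1\<close> gives both neighbour terms the sign of the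
  middle weight.\<close>

lemma path_weight_recurrence:
  assumes "s * s = 1"
  shows "2 * path_weight s \<theta> (Suc j) + s * path_weight s \<theta> j + s * path_weight s \<theta> (Suc (Suc j))
    = 4 * (cos \<theta>)\<^sup>2 * path_weight s \<theta> (Suc j)"
proof -
  define x where "x = real (2 * Suc j + 1) * \<theta>"
  have "sin (x + 2 * \<theta>) = 2 * cos (2 * \<theta>) * sin x - sin (x - 2 * \<theta>)"
    using sin_add_sin_diff[of x "2 * \<theta>"] by simp
  moreover have "path_weight s \<theta> (Suc j) = s * s ^ j * sin x"
    by (simp add: path_weight_def x_def)
  moreover have "path_weight s \<theta> j = s ^ j * sin (x - 2 * \<theta>)"
    by (simp add: path_weight_def x_def algebra_simps)
  moreover have "path_weight s \<theta> (Suc (Suc j)) = s ^ j * sin (x + 2 * \<theta>)"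
    using assms by (simp add: path_weight_def x_def distrib_right flip: mult.assoc)
  ultimately show ?thesis
    unfolding four_cos_squared by (simp only:) (simp add: algebra_simps)
qed

text \<open>The eigenvalue equation fails only at the cut: \<open>p ! Suc n\<close> receives a
  contribution from \<open>p ! n\<close>, while \<open>p ! n\<close> lacks the one from its missing
  successor.\<close>

lemma signed_laplacian_path_vector_partial:
  assumes E: "simple_graph E" and p: "pendant_path E k p" and s: "s * s = 1" and "n < k"
  shows "signed_laplacian s E *v path_vector s \<theta> (Suc n) p
    = (4 * (cos \<theta>)\<^sup>2) *\<^sub>R path_vector s \<theta> (Suc n) p
      + s *\<^sub>R (path_weight s \<theta> n *\<^sub>R axis (p ! Suc n) 1
              - path_weight s \<theta> (Suc n) *\<^sub>R axis (p ! n) 1)"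
  using \<open>n < k\<close>
proof (induction n)
  case 0
  then have nb: "{w. E (p ! 0) w} = {p ! 1}"
    using pendant_path_neighbours_0[OF p] by simp
  have *: "signed_laplacian s E *v axis (p ! 0) 1 = axis (p ! 0) 1 + s *\<^sub>R axis (p ! 1) 1"
    unfolding signed_laplacian_axis[OF E] vdegree_def nb by simp
  have "path_weight s \<theta> 0 = 4 * (cos \<theta>)\<^sup>2 * path_weight s \<theta> 0 - s * path_weight s \<theta> 1"
    using path_weight_leaf[OF s, of \<theta>] by simp
  then have "path_weight s \<theta> 0 *\<^sub>R axis (p ! 0) 1
      = (4 * (cos \<theta>)\<^sup>2 * path_weight s \<theta> 0 - s * path_weight s \<theta> 1) *\<^sub>R (axis (p ! 0) 1 :: real^'a)"
    by simp
  then show ?case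
    by (simp add: path_vector_def * algebra_simps)
next
  case (Suc n)
  note nb = pendant_path_neighbours_Suc[OF E p Suc.prems]
  have *: "signed_laplacian s E *v axis (p ! Suc n) 1
      = 2 *\<^sub>R axis (p ! Suc n) 1 + s *\<^sub>R (axis (p ! n) 1 + axis (p ! Suc (Suc n)) 1)"
    unfolding signed_laplacian_axis[OF E] vdegree_def nb(1) using nb(2) by simp
  have split: "path_vector s \<theta> (Suc (Suc n)) p
      = path_vector s \<theta> (Suc n) p + path_weight s \<theta> (Suc n) *\<^sub>R axis (p ! Suc n) 1"
    by (simp add: path_vector_def)
  \<comment> \<open>The new vertex cancels the old defect at \<open>p ! n\<close>; solved for the
    diagonal term, the recurrence settles the coefficient at \<open>p ! Suc n\<close>.\<close>
  have "2 * path_weight s \<theta> (Suc n) = 4 * (cos \<theta>)\<^sup>2 * path_weight s \<theta> (Suc n)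
      - s * path_weight s \<theta> n - s * path_weight s \<theta> (Suc (Suc n))"
    using path_weight_recurrence[OF s, of \<theta> n] by simp
  then have "(2 * path_weight s \<theta> (Suc n)) *\<^sub>R (axis (p ! Suc n) 1 :: real^'a)
      = (4 * (cos \<theta>)\<^sup>2 * path_weight s \<theta> (Suc n)
      - s * path_weight s \<theta> n - s * path_weight s \<theta> (Suc (Suc n))) *\<^sub>R axis (p ! Suc n) 1"
    by (simp only:)
  with Suc.prems show ?case
    unfolding split
    by (simp add: * Suc.IH matrix_vector_right_distrib algebra_simps)
qed

section \<open>Counting independent eigenvectors\<close>

lemma axis_nth_eq: "axis v x $ w = (if v = w then x else 0)"
  by (simp add: axis_def eq_commute)

lemma path_vector_hd:
  assumes "simple_graph E" "k \<ge> 1" "pendant_path E k p" "pendant_path E k q"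
  shows "path_vector s \<theta> k p $ (q ! 0) = (if p = q then sin \<theta> else 0)"
proof -
  have "p ! j = q ! 0 \<longleftrightarrow> j = 0 \<and> p = q" if "j < k" for j
    using pendant_path_hd_unique[OF assms that] by blast
  then have "path_weight s \<theta> j * (if p ! j = q ! 0 then 1 else 0)
      = (if j = 0 then (if p = q then sin \<theta> else 0) else 0)" if "j < k" for j
    using that by (auto simp: path_weight_def)
  then have "path_vector s \<theta> k p $ (q ! 0)
      = (\<Sum>j<k. if j = 0 then (if p = q then sin \<theta> else 0) else 0)"
    by (auto simp: path_vector_def axis_nth_eq intro!: sum.cong)
  then show ?thesis using \<open>k \<ge> 1\<close> by simp
qed

text \<open>The assumption \<open>root\<close> makes the weight vanish at the root, and
  \<open>leaf\<close> keeps it nonzero at the leaf. The additive form avoids truncated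
  subtraction.\<close>

lemma signed_laplacian_multiplicity:
  assumes E: "simple_graph E" and k: "k \<ge> 1" and s: "s * s = 1"
    and root: "sin (real (2 * k + 1) * \<theta>) = 0" and leaf: "sin \<theta> \<noteq> 0"
  shows "num_pendant_paths E k
    \<le> eigenvalue_multiplicity (signed_laplacian s E) (4 * (cos \<theta>)\<^sup>2) + num_pendant_roots E k"
proof -
  define P where "P = {xs. pendant_path E k xs}"
  \<comment> \<open>The chosen path with the same root as \<open>p\<close>; it depends on
    \<open>last p\<close> only.\<close>
  define rep where "rep p = inv_into P last (last p)" for p
  define u where "u p = path_vector s \<theta> k p" for p :: "'a list"
  let ?c = "4 * (cos \<theta>)\<^sup>2"
  have fin: "finite P"
    by (rule finite_subset[OF _ finite_lists_length_eq[OF finite_class.finite_UNIV, of "Suc k"]])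
      (auto simp: P_def pendant_path_length)
  have rep: "rep p \<in> P" "last (rep p) = last p" if "p \<in> P" for p
    using that by (auto simp: rep_def inv_into_into f_inv_into_f)
  have Mu: "signed_laplacian s E *v u p
      = ?c *\<^sub>R u p + (s * path_weight s \<theta> (k - 1)) *\<^sub>R axis (last p) 1" if "p \<in> P" for p
  proof -
    have p: "pendant_path E k p" using that by (simp add: P_def)
    have "path_weight s \<theta> k = 0" using root by (simp add: path_weight_def)
    then show ?thesis
      using signed_laplacian_path_vector_partial[OF E p s, of "k - 1" \<theta>] k
      by (simp add: u_def pendant_path_last[OF p])
  qed
  \<comment> \<open>Chosen paths are removed, as each is its own representative and would yield the
    zero vector.\<close>
  have "card (P - rep ` P) \<le> dim {x. signed_laplacian s E *v x = ?c *s x}"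
  proof (rule card_le_dim_if_dual_coordinates[where w = "\<lambda>p. u p - u (rep p)" and h = "\<lambda>p. p ! 0"])
    fix p assume "p \<in> P - rep ` P"
    then show "u p - u (rep p) \<in> {x. signed_laplacian s E *v x = ?c *s x}"
      using rep[of p]
      by (simp add: matrix_vector_mult_diff_distrib Mu scalar_mult_eq_scaleR algebra_simps)
  next
    fix p q assume "p \<in> P - rep ` P" "q \<in> P - rep ` P"
    \<comment> \<open>Hence the subtracted vector vanishes at the leaf of \<open>q\<close>.\<close>
    moreover from this have "rep p \<noteq> q" by blast
    ultimately show "(u p - u (rep p)) $ (q ! 0) = (if p = q then sin \<theta> else 0)"
      using rep[of p] path_vector_hd[OF E k] by (simp add: u_def P_def)
  qed (use fin leaf in auto)
  moreover have "rep ` P \<subseteq> P" using rep by blast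
  then have "card P = card (P - rep ` P) + card (rep ` P)"
    using fin by (simp add: card_Diff_subset card_mono finite_subset)
  \<comment> \<open>At most one path is chosen per root, because \<open>rep\<close> factors through
    \<open>last\<close>.\<close>
  moreover have "card (rep ` P) \<le> card (last ` P)"
    using card_image_le[of "last ` P" "inv_into P last"] fin by (simp add: rep_def image_image)
  moreover have "card (last ` P) \<le> num_pendant_roots E k"
    unfolding num_pendant_roots_def P_def
    by (intro card_mono) (auto simp: pendant_path_def)
  ultimately show ?thesis
    by (simp add: eigenvalue_multiplicity_def num_pendant_paths_def P_def)
qed

theorem theorem3p1:
  fixes E :: "'v::finite \<Rightarrow> 'v \<Rightarrow> bool" and k :: nat
  assumes "simple_graph E" and "k \<ge> 1"
  shows "\<forall>i \<in> {1..k}.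
    int (eigenvalue_multiplicity (laplacian E) (4 * (cos (pi * real i / (2 * real k + 1)))\<^sup>2))
      \<ge> int (num_pendant_paths E k) - int (num_pendant_roots E k) \<and>
    int (eigenvalue_multiplicity (signless_laplacian E) (4 * (cos (pi * real i / (2 * real k + 1)))\<^sup>2))
      \<ge> int (num_pendant_paths E k) - int (num_pendant_roots E k)"
proof
  fix i assume i: "i \<in> {1..k}"
  define \<theta> where "\<theta> = pi * real i / (2 * real k + 1)"
  have "real (2 * k + 1) * \<theta> = real i * pi"
    by (simp add: \<theta>_def field_simps)
  then have root: "sin (real (2 * k + 1) * \<theta>) = 0"
    by (simp only: sin_npi)
  have "0 < \<theta>"
    using i by (simp add: \<theta>_def)
  \<comment> \<open>From \<open>i \<le> k\<close> it follows that \<theta> lies strictly between 0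
    and \<open>pi\<close>, where the sine is positive.\<close>
  have "pi * real i < pi * (2 * real k + 1)"
    using i by (intro mult_strict_left_mono) auto
  then have "\<theta> < pi"
    by (simp add: \<theta>_def divide_less_eq)
  with \<open>0 < \<theta>\<close>  have leaf: "sin \<theta> \<noteq> 0"
    using sin_gt_zero[of \<theta>] by simp
  have "laplacian E = signed_laplacian (- 1) E" "signless_laplacian E = signed_laplacian 1 E"
    by (simp_all add: signed_laplacian_def laplacian_def signless_laplacian_def)
  then show "int (eigenvalue_multiplicity (laplacian E) (4 * (cos (pi * real i / (2 * real k + 1)))\<^sup>2))
      \<ge> int (num_pendant_paths E k) - int (num_pendant_roots E k) \<and>
    int (eigenvalue_multiplicity (signless_laplacian E) (4 * (cos (pi * real i / (2 * real k + 1)))\<^sup>2))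
      \<ge> int (num_pendant_paths E k) - int (num_pendant_roots E k)"
    using signed_laplacian_multiplicity[OF assms _ root leaf, of "- 1"]
      signed_laplacian_multiplicity[OF assms _ root leaf, of 1]
    by (simp flip: \<theta>_def)
qed

end
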